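(* Fix an integer $p\ge2$, a real number $s\in(-\infty,p-2]$ and $N\in\mathbb N$. If the compact set $A\subset\mathbb R^p$ is such that $$\mathbb S^{p-1}\subset A\subset\mathbb B^p,$$ then an $N$-point multiset $\omega_N^*=\{x_1,\ldots,x_N\}\subset\mathbb R^p$ satisfies $$P_s(A,\omega_N^* )=\mathcal P_s^*(A,N)$$ if and only if $x_i=0$ for all $i\in\{1,\ldots,N\}$.
   Context: $\mathbb S^{p-1}$ is the unit sphere and $\mathbb B^p$ the (closed) unit ball in $\mathbb R^p$, both centered at the origin. Riesz kernels: $K_s(x,y)=|x-y|^{-s}$ if $s>0$; $K_0(x,y)=-\log|x-y|$; $K_s(x,y)=-|x-y|^{-s}$ if $s<0$; with $K_s(x,x)=+\infty$ if $s\ge0$. For nonempty $A\subset\mathbb R^p$, $$P_s(A,\omega_N):=\inf_{y\in A}\sum_{i=1}^N K_s(x_i,y),\qquad \mathcal P_s^*(A,N):=\sup_{\omega_N\subset\mathbb R^p}P_s(A,\omega_N),$$ the supremum being over $N$-point multisets $\omega_N=\{x_1,\dots,x_N\}$ in $\mathbb R^p$ (repetitions allowed). *)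

theory Defs
  imports "HOL-Analysis.Analysis" "HOL-Library.Multiset"
begin

text \<open>The Riesz kernel with values in the extended reals. On the diagonal it is
  infinite for \<open>s \<ge> 0\<close>; for \<open>s < 0\<close> it vanishes there, since
  \<open>0 powr a = 0\<close>.\<close>

definition riesz_kernel :: "real \<Rightarrow> real ^ 'p \<Rightarrow> real ^ 'p \<Rightarrow> ereal" where
  "riesz_kernel s x y =
    (if s \<ge> 0 \<and> x = y then \<infinity>
     else if s > 0 then ereal (norm (x - y) powr (- s))
     else if s = 0 then ereal (- ln (norm (x - y)))
     else ereal (- (norm (x - y) powr (- s))))"

definition polarization :: "real \<Rightarrow> (real ^ 'p) set \<Rightarrow> (real ^ 'p) multiset \<Rightarrow> ereal" where
  "polarization s A \<omega> = (INF y\<in>A. \<Sum>x\<in>#\<omega>. riesz_kernel s x y)"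

text \<open>The points of a configuration are not confined to \<open>A\<close>: the
  supremum is over all multisets of \<open>N\<close> points of the whole space.\<close>

definition max_polarization :: "real \<Rightarrow> (real ^ 'p) set \<Rightarrow> nat \<Rightarrow> ereal" where
  "max_polarization s A N = (SUP \<omega>\<in>{\<omega>. size \<omega> = N}. polarization s A \<omega>)"

end

theory Submission
  imports Defs "HOL-Complex_Analysis.Complex_Analysis"
begin

text \<open>A configuration that polarizes at least as well as \<open>N\<close> copies of the origin
  also does so for the larger exponent \<open>s = p - 2\<close>, because the normalised kernels increase with
  \<open>s\<close>; so only the harmonic case matters. There the Kelvin transform of the potential is
  harmonic off its poles, nonnegative (after normalisation) on the unit sphere and zero at the origin.
  By the minimum principle it vanishes near the origin, hence by analytic continuation along the
  ray through a point \<open>x\<^sub>j\<close> of maximal norm up to the inverse point of \<open>x\<^sub>j\<close>, where it must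
  blow up. So all points are at the origin.\<close>

section \<open>Laplacians along coordinate lines\<close>

text \<open>A pointwise relation: first derivatives along each coordinate line are required only
  near \<open>y\<close>, second derivatives only at \<open>y\<close>. This is what the second
  derivative test at a minimum consumes.\<close>

definition has_laplacian :: "('a::euclidean_space \<Rightarrow> real) \<Rightarrow> real \<Rightarrow> 'a \<Rightarrow> bool" where
  "has_laplacian f L y \<longleftrightarrow>
    (\<exists>g d. (\<forall>b\<in>Basis. (\<forall>\<^sub>F t in nhds 0. ((\<lambda>t. f (y + t *\<^sub>R b)) has_real_derivative g b t) (at t)) \<and>
        (g b has_real_derivative d b) (at 0)) \<and> L = (\<Sum>b\<in>Basis. d b))"

lemma has_laplacian_add:
  assumes "has_laplacian f L y" "has_laplacian g M y"
  shows "has_laplacian (\<lambda>y. f y + g y) (L + M) y"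
proof -
  obtain f1 d where f: "\<And>b. b \<in> Basis \<Longrightarrow> \<forall>\<^sub>F t in nhds 0. ((\<lambda>t. f (y + t *\<^sub>R b)) has_real_derivative f1 b t) (at t)"
    "\<And>b. b \<in> Basis \<Longrightarrow> (f1 b has_real_derivative d b) (at 0)" "L = (\<Sum>b\<in>Basis. d b)"
    using assms(1) unfolding has_laplacian_def by blast
  obtain g1 e where g: "\<And>b. b \<in> Basis \<Longrightarrow> \<forall>\<^sub>F t in nhds 0. ((\<lambda>t. g (y + t *\<^sub>R b)) has_real_derivative g1 b t) (at t)"
    "\<And>b. b \<in> Basis \<Longrightarrow> (g1 b has_real_derivative e b) (at 0)" "M = (\<Sum>b\<in>Basis. e b)"
    using assms(2) unfolding has_laplacian_def by blast
  show ?thesis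
    unfolding has_laplacian_def
  proof (intro exI conjI ballI)
    fix b :: 'a assume b: "b \<in> Basis"
    show "\<forall>\<^sub>F t in nhds 0. ((\<lambda>t. f (y + t *\<^sub>R b) + g (y + t *\<^sub>R b)) has_real_derivative f1 b t + g1 b t) (at t)"
      using f(1)[OF b] g(1)[OF b] by eventually_elim (rule DERIV_add)
    show "((\<lambda>t. f1 b t + g1 b t) has_real_derivative d b + e b) (at 0)"
      using f(2)[OF b] g(2)[OF b] by (rule DERIV_add)
  qed (simp add: f(3) g(3) sum.distrib)
qed

lemma has_laplacian_cmult:
  assumes "has_laplacian f L y"
  shows "has_laplacian (\<lambda>y. c * f y) (c * L) y"
proof -
  obtain f1 d where f: "\<And>b. b \<in> Basis \<Longrightarrow> \<forall>\<^sub>F t in nhds 0. ((\<lambda>t. f (y + t *\<^sub>R b)) has_real_derivative f1 b t) (at t)"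
    "\<And>b. b \<in> Basis \<Longrightarrow> (f1 b has_real_derivative d b) (at 0)" "L = (\<Sum>b\<in>Basis. d b)"
    using assms(1) unfolding has_laplacian_def by blast
  show ?thesis
    unfolding has_laplacian_def
  proof (intro exI conjI ballI)
    fix b :: 'a assume b: "b \<in> Basis"
    show "\<forall>\<^sub>F t in nhds 0. ((\<lambda>t. c * f (y + t *\<^sub>R b)) has_real_derivative c * f1 b t) (at t)"
      using f(1)[OF b] by eventually_elim (rule DERIV_cmult)
    show "((\<lambda>t. c * f1 b t) has_real_derivative c * d b) (at 0)"
      using f(2)[OF b] by (rule DERIV_cmult)
  qed (simp add: f(3) sum_distrib_left)
qed

lemma has_laplacian_sum:
  assumes "finite I" "\<And>i. i \<in> I \<Longrightarrow> has_laplacian (f i) (L i) y"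
  shows "has_laplacian (\<lambda>y. \<Sum>i\<in>I. f i y) (\<Sum>i\<in>I. L i) y"
  using assms
proof (induction I rule: finite_induct)
  case empty
  show ?case
    unfolding has_laplacian_def
    by (rule exI[of _ "\<lambda>_ _. 0"], rule exI[of _ "\<lambda>_. 0"]) auto
qed (auto intro: has_laplacian_add)

text \<open>If \<open>d < 0\<close>, then \<open>f1\<close>, which is 0 at the minimum, is negative
  just to the right of it, and the mean value theorem puts \<open>f\<close> below \<open>f 0\<close>
  there.\<close>

lemma second_derivative_nonneg_at_local_min:
  fixes f f1 :: "real \<Rightarrow> real"
  assumes deriv: "\<forall>\<^sub>F t in nhds 0. (f has_real_derivative f1 t) (at t)"
    and second: "(f1 has_real_derivative d) (at 0)"
    and min: "\<forall>\<^sub>F t in nhds 0. f 0 \<le> f t"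
  shows "0 \<le> d"
proof (rule ccontr)
  assume "\<not> 0 \<le> d"
  then have "d < 0" by simp
  obtain e where e: "e > 0" "\<And>t. \<bar>t\<bar> < e \<Longrightarrow> (f has_real_derivative f1 t) (at t)"
      "\<And>t. \<bar>t\<bar> < e \<Longrightarrow> f 0 \<le> f t"
    using eventually_conj[OF deriv min] unfolding eventually_nhds_metric by (auto simp: dist_real_def)
  have "f1 0 = 0"
    by (rule DERIV_local_min[OF e(2) e(1)]) (use e in auto)
  obtain e' where e': "e' > 0" "\<And>h. 0 < h \<Longrightarrow> h < e' \<Longrightarrow> f1 h < 0"
    using DERIV_neg_dec_right[OF second \<open>d < 0\<close>] \<open>f1 0 = 0\<close> by auto
  define h where "h = min e e' / 2"
  have h: "0 < h" "h < e" "h < e'" using e(1) e'(1) by (auto simp: h_def)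
  have "\<exists>z. 0 < z \<and> z < h \<and> f h - f 0 = (h - 0) * f1 z"
    by (rule MVT2) (use h e(2) in auto)
  then obtain z where z: "0 < z" "z < h" "f h - f 0 = h * f1 z" by auto
  have "h * f1 z < 0" using z h e'(2)[of z] by (simp add: mult_pos_neg)
  with z(3) e(3)[of h] h show False by auto
qed

lemma laplacian_nonneg_at_local_min:
  assumes "has_laplacian f L y" and "\<forall>\<^sub>F w in nhds y. f y \<le> f w"
  shows "0 \<le> L"
proof -
  obtain f1 d where f: "\<And>b. b \<in> Basis \<Longrightarrow> \<forall>\<^sub>F t in nhds 0. ((\<lambda>t. f (y + t *\<^sub>R b)) has_real_derivative f1 b t) (at t)"
    "\<And>b. b \<in> Basis \<Longrightarrow> (f1 b has_real_derivative d b) (at 0)" "L = (\<Sum>b\<in>Basis. d b)"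
    using assms(1) unfolding has_laplacian_def by blast
  have "0 \<le> d b" if b: "b \<in> Basis" for b
  proof (rule second_derivative_nonneg_at_local_min[OF f(1)[OF b] f(2)[OF b]])
    have "((\<lambda>t. y + t *\<^sub>R b) \<longlongrightarrow> y + 0 *\<^sub>R b) (nhds 0)"
      by (intro tendsto_intros filterlim_ident)
    then show "\<forall>\<^sub>F t in nhds 0. f (y + 0 *\<^sub>R b) \<le> f (y + t *\<^sub>R b)"
      using assms(2) by (auto simp: filterlim_iff)
  qed
  then show ?thesis unfolding f(3) by (rule sum_nonneg)
qed

section \<open>The kernel as a function of the squared distance\<close>

text \<open>The additive and multiplicative normalisation gives all exponents the common value
  zero at distance one and makes the kernel increasing in \<open>s\<close>.\<close>

definition kern :: "real \<Rightarrow> real \<Rightarrow> real" where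
  "kern s q = (if s = 0 then - ln q / 2 else (q powr (- s / 2) - 1) / s)"

lemma kern_1 [simp]: "kern s 1 = 0"
  by (simp add: kern_def)

text \<open>Thanks to the normalisation one formula also covers the logarithm, so the monotonicity
  facts below need no split on \<open>s = 0\<close>.\<close>

lemma DERIV_kern:
  assumes "q > 0"
  shows "(kern s has_real_derivative (- (q powr (- s / 2 - 1)) / 2)) (at q)"
proof (cases "s = 0")
  case True
  have "((\<lambda>q. - ln q / 2) has_real_derivative (- (q powr (- s / 2 - 1)) / 2)) (at q)"
    using assms True by (auto intro!: derivative_eq_intros simp: powr_minus_divide)
  then show ?thesis using True by (simp add: kern_def[abs_def])
next
  case False
  have "((\<lambda>q. (q powr (- s / 2) - 1) / s) has_real_derivative (- (q powr (- s / 2 - 1)) / 2)) (at q)"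
    using assms False by (auto intro!: derivative_eq_intros)
  then show ?thesis using False by (simp add: kern_def[abs_def])
qed

lemma continuous_on_kern:
  assumes "continuous_on S f" "\<And>x. x \<in> S \<Longrightarrow> f x > 0"
  shows "continuous_on S (\<lambda>x. kern s (f x))"
proof -
  have "continuous_on {0<..} (kern s)"
    by (auto intro!: continuous_at_imp_continuous_on DERIV_isCont[OF DERIV_kern])
  then show ?thesis
    by (rule continuous_on_compose2[OF _ assms(1)]) (use assms(2) in auto)
qed

lemma kern_antimono:
  assumes "0 < a" "a \<le> b"
  shows "kern s b \<le> kern s a"
proof (rule DERIV_nonpos_imp_nonincreasing[OF assms(2)])
  fix q assume "a \<le> q" "q \<le> b"
  then show "\<exists>y. (kern s has_real_derivative y) (at q) \<and> y \<le> 0"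
    using assms DERIV_kern[of q s] by (intro exI conjI) auto
qed

lemma kern_strict_antimono:
  assumes "0 < a" "a < b"
  shows "kern s b < kern s a"
proof (rule DERIV_neg_imp_decreasing[OF assms(2)])
  fix q assume "a \<le> q" "q \<le> b"
  then show "\<exists>y. (kern s has_real_derivative y) (at q) \<and> y < 0"
    using assms DERIV_kern[of q s] by (intro exI conjI) auto
qed

text \<open>The difference of the two kernels vanishes at \<open>q = 1\<close>; it is nonincreasing
  before 1 and nondecreasing after it.\<close>

lemma kern_mono_exponent:
  assumes "s \<le> s'" "q > 0"
  shows "kern s q \<le> kern s' q"
proof -
  define h where "h q = kern s' q - kern s q" for q
  have h: "(h has_real_derivative (q powr (- s / 2 - 1) - q powr (- s' / 2 - 1)) / 2) (at q)" if "q > 0" for q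
    unfolding h_def using DERIV_diff[OF DERIV_kern[OF that] DERIV_kern[OF that]]
    by (simp add: diff_divide_distrib)
  have "h 1 \<le> h q"
  proof (cases "q \<ge> 1")
    case True
    show ?thesis
    proof (rule DERIV_nonneg_imp_nondecreasing[OF True])
      fix u :: real assume "1 \<le> u" "u \<le> q"
      then show "\<exists>y. (h has_real_derivative y) (at u) \<and> 0 \<le> y"
        using h[of u] assms by (intro exI conjI) (auto intro!: powr_mono)
    qed
  next
    case False
    then have "q \<le> 1" by simp
    then show ?thesis
    proof (rule DERIV_nonpos_imp_nonincreasing)
      fix u :: real assume "q \<le> u" "u \<le> 1"
      then show "\<exists>y. (h has_real_derivative y) (at u) \<and> y \<le> 0"
        using h[of u] assms by (intro exI conjI) (auto intro!: powr_mono')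
    qed
  qed
  then show ?thesis by (simp add: h_def)
qed

text \<open>Comparison with the logarithmic kernel, which equals \<open>M\<close> at
  \<open>exp (- 2 * M)\<close>.\<close>

lemma kern_unbounded:
  assumes "s \<ge> 0"
  obtains \<delta> where "\<delta> > 0" "kern s \<delta> \<ge> M"
proof -
  have "kern 0 (exp (- 2 * M)) \<le> kern s (exp (- 2 * M))"
    using assms by (intro kern_mono_exponent) auto
  then show ?thesis by (intro that[of "exp (- 2 * M)"]) (auto simp: kern_def)
qed

text \<open>The relation \<open>c * d = x \<bullet> x\<close> makes the squared gradient of
  \<open>P\<close> equal to \<open>4 * c * P\<close>, so both terms of the chain rule collapse to
  the same power of \<open>P\<close>. It is used with \<open>d = 1\<close> for
  \<open>image_dist_sq\<close> and with \<open>c = 1\<close> for the squared distance to a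
  point.\<close>

lemma has_laplacian_kern_quadratic:
  fixes x y :: "'a::euclidean_space" and c d s :: real
  defines "P \<equiv> \<lambda>y. c * (y \<bullet> y) - 2 * (x \<bullet> y) + d"
  assumes cd: "c * d = x \<bullet> x" and pos: "P y > 0"
  shows "has_laplacian (\<lambda>y. kern s (P y)) (c * (s + 2 - DIM('a)) * P y powr (- s / 2 - 1)) y"
proof -
  define P1 where "P1 b t = 2 * c * (y \<bullet> b) - 2 * (x \<bullet> b) + 2 * c * t" for b t
  have line: "P (y + t *\<^sub>R b) = P y + t * (2 * c * (y \<bullet> b) - 2 * (x \<bullet> b)) + c * t\<^sup>2" if "b \<in> Basis" for b t
    using that by (simp add: P_def inner_add_left inner_add_right algebra_simps power2_eq_square inner_commute[of b y])
  have derP: "((\<lambda>t. P (y + t *\<^sub>R b)) has_real_derivative P1 b t) (at t)" if "b \<in> Basis" for b t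
    unfolding line[OF that] P1_def by (auto intro!: derivative_eq_intros)
  \<comment> \<open>Chain rule for the second derivative along \<open>b\<close>:
    \<open>P1 b 0\<close> is the first and \<open>2 * c\<close> the second derivative of
    \<open>P\<close>.\<close>
  define D where "D b = ((s / 2 + 1) * P y powr (- s / 2 - 2) * (P1 b 0)\<^sup>2 - P y powr (- s / 2 - 1) * (2 * c)) / 2" for b
  have "(\<Sum>b\<in>Basis. (P1 b 0)\<^sup>2) = 4 * ((c *\<^sub>R y - x) \<bullet> (c *\<^sub>R y - x))"
    unfolding P1_def by (subst euclidean_inner) (simp add: sum_distrib_left power2_eq_square inner_diff_left algebra_simps)
  also have "\<dots> = 4 * c * P y"
    using cd by (simp add: P_def inner_diff_left inner_diff_right inner_commute algebra_simps)
  finally have sumsq: "(\<Sum>b\<in>Basis. (P1 b 0)\<^sup>2) = 4 * c * P y" .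
  have "(\<Sum>b\<in>Basis. D b) = ((s / 2 + 1) * P y powr (- s / 2 - 2) * (\<Sum>b\<in>Basis. (P1 b 0)\<^sup>2) 
      - DIM('a) * (P y powr (- s / 2 - 1) * (2 * c))) / 2"
    unfolding D_def by (simp add: sum_distrib_left sum_subtractf sum_divide_distrib[symmetric])
  also have "\<dots> = ((s / 2 + 1) * 4 * c * (P y powr (- s / 2 - 2) * P y)
      - DIM('a) * (P y powr (- s / 2 - 1) * (2 * c))) / 2"
    unfolding sumsq by (simp add: algebra_simps)
  also have "P y powr (- s / 2 - 2) * P y = P y powr (- s / 2 - 1)"
  proof -
    have "- s / 2 - 1 = (- s / 2 - 2) + 1" by simp
    then show ?thesis using pos by (simp only: powr_add) simp
  qed
  finally have sumD: "c * (s + 2 - DIM('a)) * P y powr (- s / 2 - 1) = (\<Sum>b\<in>Basis. D b)"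
    by (simp add: algebra_simps)
  show ?thesis
    unfolding has_laplacian_def
  proof (intro exI conjI ballI)
    fix b :: 'a assume b: "b \<in> Basis"
    have "((\<lambda>t. y + t *\<^sub>R b) \<longlongrightarrow> y + 0 *\<^sub>R b) (nhds 0)"
      by (intro tendsto_intros filterlim_ident)
    then have "((\<lambda>t. P (y + t *\<^sub>R b)) \<longlongrightarrow> P (y + 0 *\<^sub>R b)) (nhds 0)"
      unfolding P_def by (intro tendsto_intros filterlim_ident)
    then have "\<forall>\<^sub>F t in nhds 0. P (y + t *\<^sub>R b) > 0"
      using pos by (auto intro: order_tendstoD(1))
    then show "\<forall>\<^sub>F t in nhds 0. ((\<lambda>t. kern s (P (y + t *\<^sub>R b))) has_real_derivative
        - (P (y + t *\<^sub>R b) powr (- s / 2 - 1)) / 2 * P1 b t) (at t)"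
      by eventually_elim (rule DERIV_chain2[OF DERIV_kern derP[OF b]])
    have "((\<lambda>t. - (P (y + t *\<^sub>R b) powr (- s / 2 - 1)) / 2) has_real_derivative
        - ((- s / 2 - 1) * P (y + 0 *\<^sub>R b) powr (- s / 2 - 1 - 1) * P1 b 0) / 2) (at 0)"
      using pos derP[OF b, of 0] by (auto intro!: derivative_eq_intros DERIV_fun_powr)
    moreover have "(P1 b has_real_derivative 2 * c) (at 0)"
      unfolding P1_def by (auto intro!: derivative_eq_intros)
    ultimately have "((\<lambda>t. - (P (y + t *\<^sub>R b) powr (- s / 2 - 1)) / 2 * P1 b t) has_real_derivative
       - ((- s / 2 - 1) * P (y + 0 *\<^sub>R b) powr (- s / 2 - 1 - 1) * P1 b 0) / 2 * P1 b 0
         + 2 * c * (- (P (y + 0 *\<^sub>R b) powr (- s / 2 - 1)) / 2)) (at 0)"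
      by (rule DERIV_mult)
    moreover have "- s / 2 - 1 - 1 = - s / 2 - 2" by simp
    ultimately show "((\<lambda>t. - (P (y + t *\<^sub>R b) powr (- s / 2 - 1)) / 2 * P1 b t) has_real_derivative D b) (at 0)"
      by (simp add: D_def power2_eq_square algebra_simps diff_divide_distrib add_divide_distrib)
  qed (rule sumD)
qed


section \<open>Kelvin transform of the potential\<close>

text \<open>On the unit sphere this is the squared distance from \<open>x\<close> to \<open>y\<close>; elsewhere it is
  \<open>(norm x)\<^sup>2\<close> times the squared distance from \<open>y\<close> to the inverse point of \<open>x\<close>.\<close>

definition image_dist_sq :: "'a::real_inner \<Rightarrow> 'a \<Rightarrow> real" where
  "image_dist_sq x y = 1 - 2 * (x \<bullet> y) + (x \<bullet> x) * (y \<bullet> y)"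

text \<open>For \<open>y \<noteq> 0\<close>, \<open>image_dist_sq x y\<close> is also
  \<open>(norm y)\<^sup>2\<close> times the squared distance from \<open>x\<close> to the inverse
  point of \<open>y\<close>. So for the harmonic exponent each summand is, up to normalisation, the
  Kelvin transform of the kernel with pole \<open>x i\<close> (for the logarithm, its
  analogue).\<close>

definition potential :: "real \<Rightarrow> 'i set \<Rightarrow> ('i \<Rightarrow> 'a::real_inner) \<Rightarrow> 'a \<Rightarrow> real" where
  "potential s I x y = (\<Sum>i\<in>I. kern s (image_dist_sq (x i) y))"

lemma image_dist_sq_sphere:
  assumes "norm y = 1"
  shows "image_dist_sq x y = (norm (x - y))\<^sup>2"
  using assms
  by (simp add: image_dist_sq_def power2_norm_eq_inner inner_diff_left inner_diff_right inner_commute norm_eq_1)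

lemma image_dist_sq_le: "image_dist_sq x y \<le> (1 + norm x * norm y)\<^sup>2"
proof -
  have "- (x \<bullet> y) \<le> norm x * norm y" using Cauchy_Schwarz_ineq2[of x y] by linarith
  then show ?thesis
    unfolding image_dist_sq_def power2_norm_eq_inner[symmetric] by (simp add: power2_eq_square algebra_simps)
qed

lemma image_dist_sq_ge: "(1 - norm x * norm y)\<^sup>2 \<le> image_dist_sq x y"
proof -
  have "x \<bullet> y \<le> norm x * norm y" using Cauchy_Schwarz_ineq2[of x y] by linarith
  then show ?thesis
    unfolding image_dist_sq_def power2_norm_eq_inner[symmetric] by (simp add: power2_eq_square algebra_simps)
qed

lemma continuous_on_image_dist_sq [continuous_intros]:
  "continuous_on S f \<Longrightarrow> continuous_on S (\<lambda>y. image_dist_sq x (f y))"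
  unfolding image_dist_sq_def by (intro continuous_intros)

lemma potential_0 [simp]: "potential s I x 0 = 0"
  by (simp add: potential_def image_dist_sq_def)

lemma continuous_on_potential:
  assumes "\<And>y i. y \<in> S \<Longrightarrow> i \<in> I \<Longrightarrow> image_dist_sq (x i) y > 0"
  shows "continuous_on S (potential s I x)"
  unfolding potential_def
  by (intro continuous_on_sum continuous_on_kern continuous_intros) (use assms in auto)

text \<open>The factor \<open>s + 2 - DIM('a)\<close> of the Laplacian vanishes for this
  exponent.\<close>

lemma potential_harmonic:
  fixes x :: "'i \<Rightarrow> 'a::euclidean_space"
  assumes "finite I" "s = real DIM('a) - 2" "\<And>i. i \<in> I \<Longrightarrow> image_dist_sq (x i) y > 0"
  shows "has_laplacian (potential s I x) 0 y"
proof -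
  have "has_laplacian (\<lambda>y. kern s (image_dist_sq (x i) y)) 0 y" if "i \<in> I" for i
  proof -
    have eq: "image_dist_sq (x i) y = (x i \<bullet> x i) * (y \<bullet> y) - 2 * (x i \<bullet> y) + 1" for y
      by (simp add: image_dist_sq_def)
    show ?thesis
      using has_laplacian_kern_quadratic[of "x i \<bullet> x i" 1 "x i" y s] assms(3)[OF that]
      unfolding eq assms(2) by simp
  qed
  then show ?thesis
    using has_laplacian_sum[OF assms(1), of "\<lambda>i y. kern s (image_dist_sq (x i) y)" "\<lambda>_. 0" y]
    by (simp add: potential_def[abs_def])
qed

section \<open>Barrier and minimum principles for the potential\<close>

lemma barrier_subharmonic:
  fixes y z :: "'a::euclidean_space"
  assumes "s = real DIM('a) - 2" "y \<noteq> z"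
  obtains L where "L > 0" "has_laplacian (\<lambda>y. kern (s + 1) ((norm (y - z))\<^sup>2)) L y"
proof -
  have eq: "(norm (y - z))\<^sup>2 = 1 * (y \<bullet> y) - 2 * (z \<bullet> y) + z \<bullet> z" for y
    by (simp add: power2_norm_eq_inner inner_diff_left inner_diff_right inner_commute)
  have pos: "(norm (y - z))\<^sup>2 > 0" using assms by simp
  have "has_laplacian (\<lambda>y. kern (s + 1) ((norm (y - z))\<^sup>2))
      (1 * (s + 1 + 2 - DIM('a)) * (norm (y - z))\<^sup>2 powr (- (s + 1) / 2 - 1)) y"
    unfolding eq by (rule has_laplacian_kern_quadratic) (use pos in \<open>simp_all only: eq mult_1\<close>)
  \<comment> \<open>One above the harmonic exponent the dimensional factor is 1. Subtracting a
    positive multiple of the barrier will make the potential strictly superharmonic.\<close>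
  moreover have "1 * (s + 1 + 2 - DIM('a)) * (norm (y - z))\<^sup>2 powr (- (s + 1) / 2 - 1) > 0"
    using assms by simp
  ultimately show ?thesis by (rule that[rotated])
qed

lemma potential_large_near_poles:
  fixes x :: "'i \<Rightarrow> 'a::euclidean_space"
  assumes fin: "finite I" and "s \<ge> 0" and "bounded K"
  obtains \<delta> where "\<delta> > 0"
    "\<And>y j. y \<in> K \<Longrightarrow> (\<And>i. i \<in> I \<Longrightarrow> image_dist_sq (x i) y > 0) \<Longrightarrow> j \<in> I \<Longrightarrow>
        image_dist_sq (x j) y \<le> \<delta> \<Longrightarrow> M \<le> potential s I x y"
proof -
  obtain R where R: "R > 0" "\<And>y. y \<in> K \<Longrightarrow> norm y \<le> R"
    using assms(3) bounded_pos by blast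
  define B where "B = (1 + (\<Sum>i\<in>I. norm (x i)) * R)\<^sup>2"
  define m where "m = \<bar>kern s B\<bar>"
  \<comment> \<open>The summand near its pole has to outweigh all the others, each of which is at
    least \<open>- m\<close> on \<open>K\<close>.\<close>
  obtain \<delta> where \<delta>: "\<delta> > 0" "kern s \<delta> \<ge> M + card I * m"
    using kern_unbounded[OF assms(2)] by blast
  show ?thesis
  proof (rule that[OF \<delta>(1)])
    fix y j assume y: "y \<in> K" "\<And>i. i \<in> I \<Longrightarrow> image_dist_sq (x i) y > 0"
      and j: "j \<in> I" "image_dist_sq (x j) y \<le> \<delta>"
    have lower: "- m \<le> kern s (image_dist_sq (x i) y)" if i: "i \<in> I" for i
    proof -
      have "norm (x i) \<le> (\<Sum>i\<in>I. norm (x i))"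
        by (rule member_le_sum) (use i fin in auto)
      then have "(1 + norm (x i) * norm y)\<^sup>2 \<le> B"
        unfolding B_def using R y(1) by (intro power_mono add_left_mono mult_mono) (auto simp: sum_nonneg)
      then have "kern s B \<le> kern s (image_dist_sq (x i) y)"
        using image_dist_sq_le[of "x i" y] y(2)[OF i] by (intro kern_antimono) auto
      then show ?thesis by (simp add: m_def)
    qed
    have "M \<le> kern s \<delta> - card I * m" using \<delta> by simp
    also have "\<dots> \<le> kern s (image_dist_sq (x j) y) - card (I - {j}) * m"
    proof (rule diff_mono)
      show "kern s \<delta> \<le> kern s (image_dist_sq (x j) y)"
        using j y by (intro kern_antimono) auto
      show "card (I - {j}) * m \<le> card I * m"
        using fin by (intro mult_right_mono) (auto simp: m_def card_Diff1_le)
    qed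
    also have "\<dots> = kern s (image_dist_sq (x j) y) + (\<Sum>i\<in>I - {j}. - m)" by simp
    also have "\<dots> \<le> kern s (image_dist_sq (x j) y) + (\<Sum>i\<in>I - {j}. kern s (image_dist_sq (x i) y))"
      by (intro add_left_mono sum_mono lower) auto
    also have "\<dots> = potential s I x y"
      unfolding potential_def using fin j by (simp add: sum.remove)
    finally show "M \<le> potential s I x y" .
  qed
qed

text \<open>The weak minimum principle; the poles need no attention because the potential is large there.\<close>

lemma potential_comparison:
  fixes x :: "'i \<Rightarrow> 'a::euclidean_space"
  assumes fin: "finite I" and s: "s = real DIM('a) - 2" "s \<ge> 0"
    and K: "compact K" "z \<notin> K" and "\<epsilon> > 0"
    and bd: "\<And>y. y \<in> K - interior K \<Longrightarrow> (\<And>i. i \<in> I \<Longrightarrow> image_dist_sq (x i) y > 0) \<Longrightarrow>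
        C \<le> potential s I x y - \<epsilon> * kern (s + 1) ((norm (y - z))\<^sup>2)"
    and y: "y \<in> K" "\<And>i. i \<in> I \<Longrightarrow> image_dist_sq (x i) y > 0"
  shows "C \<le> potential s I x y - \<epsilon> * kern (s + 1) ((norm (y - z))\<^sup>2)"
proof (rule ccontr)
  define q where "q y = kern (s + 1) ((norm (y - z))\<^sup>2)" for y
  define g where "g y = potential s I x y + (- \<epsilon>) * q y" for y
  assume "\<not> ?thesis"
  then have less: "g y < C" by (simp add: g_def q_def)
  have cont_q: "continuous_on K q"
    unfolding q_def by (intro continuous_on_kern continuous_intros) (use K in auto)
  obtain u where u: "u \<in> K" "\<And>w. w \<in> K \<Longrightarrow> q w \<le> q u"
    using continuous_attains_sup[OF K(1) _ cont_q] y(1) by blast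
  obtain \<delta> where \<delta>: "\<delta> > 0"
    "\<And>w j. w \<in> K \<Longrightarrow> (\<And>i. i \<in> I \<Longrightarrow> image_dist_sq (x i) w > 0) \<Longrightarrow> j \<in> I \<Longrightarrow>
        image_dist_sq (x j) w \<le> \<delta> \<Longrightarrow> C + \<epsilon> * q u \<le> potential s I x w"
    using potential_large_near_poles[OF fin s(2) compact_imp_bounded[OF K(1)]] by metis
  \<comment> \<open>Where \<open>image_dist_sq\<close> is at most \<open>\<delta>\<close>, the
    potential exceeds \<open>C\<close> even after subtracting the largest value of the barrier
    term.\<close>
  have away: "\<delta> < image_dist_sq (x j) w"
    if "w \<in> K" "\<And>i. i \<in> I \<Longrightarrow> image_dist_sq (x i) w > 0" "g w < C" "j \<in> I" for w j
  proof (rule ccontr)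
    assume "\<not> ?thesis"
    then have "C + \<epsilon> * q u \<le> potential s I x w" using \<delta>(2)[OF that(1,2,4)] by simp
    moreover have "\<epsilon> * q w \<le> \<epsilon> * q u" using u(2)[OF that(1)] \<open>\<epsilon> > 0\<close> by simp
    ultimately show False using that(3) by (simp add: g_def)
  qed
  \<comment> \<open>Cutting out the poles leaves a compact set on which \<open>g\<close> is
    continuous. Its minimum is below \<open>C\<close>, so by \<open>bd\<close> and
    \<open>away\<close> it is attained off every boundary. It is thus a true local minimum, which
    the negative Laplacian of \<open>g\<close> forbids.\<close>
  define K' where "K' = {w \<in> K. \<forall>i\<in>I. \<delta> \<le> image_dist_sq (x i) w}"
  have "closed (\<Inter>i\<in>I. {w. \<delta> \<le> image_dist_sq (x i) w})"
    by (intro closed_INT ballI closed_Collect_le continuous_intros)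
  moreover have "K' = K \<inter> (\<Inter>i\<in>I. {w. \<delta> \<le> image_dist_sq (x i) w})" by (auto simp: K'_def)
  ultimately have "compact K'" using K(1) by (simp add: compact_Int_closed)
  moreover have "y \<in> K'" using y(1) away[OF y less] by (auto simp: K'_def intro: less_imp_le)
  moreover have "continuous_on K' g"
    unfolding g_def
    by (intro continuous_intros continuous_on_potential continuous_on_subset[OF cont_q])
       (use \<delta>(1) in \<open>auto simp: K'_def intro: less_le_trans\<close>)
  ultimately obtain v where v: "v \<in> K'" "\<And>w. w \<in> K' \<Longrightarrow> g v \<le> g w"
    using continuous_attains_inf[of K' g] by blast
  have vC: "g v < C" using v(2)[OF \<open>y \<in> K'\<close>] less by simp
  have vpos: "image_dist_sq (x i) v > 0" if "i \<in> I" for i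
    using v(1) \<delta>(1) that by (auto simp: K'_def intro: less_le_trans)
  have vK: "v \<in> K" using v(1) by (simp add: K'_def)
  have "v \<in> interior K"
    using bd[of v] vK vpos vC by (force simp: g_def q_def)
  then have "\<forall>\<^sub>F w in nhds v. w \<in> interior K"
    by (simp add: eventually_nhds_in_open)
  moreover have "\<forall>\<^sub>F w in nhds v. \<forall>i\<in>I. \<delta> < image_dist_sq (x i) w"
  proof (intro eventually_ball_finite fin ballI)
    fix i assume "i \<in> I"
    have "open {w. \<delta> < image_dist_sq (x i) w}"
      by (intro open_Collect_less continuous_intros)
    then show "\<forall>\<^sub>F w in nhds v. \<delta> < image_dist_sq (x i) w"
      using away[OF vK vpos vC \<open>i \<in> I\<close>] eventually_nhds_in_open[of "{w. \<delta> < image_dist_sq (x i) w}" v] by auto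
  qed
  ultimately have "\<forall>\<^sub>F w in nhds v. g v \<le> g w"
  proof eventually_elim
    case (elim w)
    then have "w \<in> K'" using interior_subset by (auto simp: K'_def intro: less_imp_le)
    then show ?case by (rule v(2))
  qed
  moreover obtain L where L: "L > 0" "has_laplacian q L v"
    using barrier_subharmonic[OF s(1), of v z] vK K(2) unfolding q_def by metis
  have "has_laplacian g (0 + (- \<epsilon>) * L) v"
    unfolding g_def
    by (intro has_laplacian_add has_laplacian_cmult L(2) potential_harmonic fin s vpos)
  ultimately have "0 \<le> 0 + (- \<epsilon>) * L" by (rule laplacian_nonneg_at_local_min[rotated])
  then show False using L(1) \<open>\<epsilon> > 0\<close> by (simp add: mult_le_0_iff)
qed


text \<open>Comparison on the unit ball with a barrier centred at distance 2 from the origin. All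
  points of the ball have distance at least 1 from that centre, so the barrier is nonpositive there
  and subtracting it preserves the boundary inequality.\<close>

lemma potential_nonneg_ball:
  fixes x :: "'i \<Rightarrow> 'a::euclidean_space"
  assumes fin: "finite I" and s: "s = real DIM('a) - 2" "s \<ge> 0"
    and sphere: "\<And>y. norm y = 1 \<Longrightarrow> (\<And>i. i \<in> I \<Longrightarrow> image_dist_sq (x i) y > 0) \<Longrightarrow> 0 \<le> potential s I x y"
    and y: "norm y \<le> 1" "\<And>i. i \<in> I \<Longrightarrow> image_dist_sq (x i) y > 0"
  shows "0 \<le> potential s I x y"
proof -
  obtain b :: 'a where "b \<in> Basis" using nonempty_Basis by blast
  define z where "z = 2 *\<^sub>R b"
  have z: "norm z = 2" using \<open>b \<in> Basis\<close> by (simp add: z_def)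
  define q where "q y = kern (s + 1) ((norm (y - z))\<^sup>2)" for y
  have q: "q y \<le> 0" if "norm y \<le> 1" for y
  proof -
    have "1 \<le> norm (y - z)" using norm_triangle_ineq2[of z y] z that by (simp add: norm_minus_commute)
    then have "1 \<le> (norm (y - z))\<^sup>2" by (rule one_le_power)
    then show ?thesis using kern_antimono[of 1 "(norm (y - z))\<^sup>2" "s + 1"] by (simp add: q_def)
  qed
  have le: "0 \<le> potential s I x y - \<epsilon> * q y" if "\<epsilon> > 0" for \<epsilon>
    unfolding q_def
  proof (rule potential_comparison[OF fin s compact_cball[of 0 1]])
    fix w :: 'a assume w: "w \<in> cball 0 1 - interior (cball 0 1)" "\<And>i. i \<in> I \<Longrightarrow> image_dist_sq (x i) w > 0"
    then have "norm w = 1" by (simp add: interior_cball)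
    then show "0 \<le> potential s I x w - \<epsilon> * kern (s + 1) ((norm (w - z))\<^sup>2)"
      using sphere[of w] w(2) q[of w] that mult_nonneg_nonpos[of \<epsilon> "q w"] by (simp add: q_def)
  qed (use y z that in auto)
  show ?thesis
  proof (rule ccontr)
    assume neg: "\<not> ?thesis"
    show False
    proof (cases "q y = 0")
      case True
      then show ?thesis using le[of 1] neg by simp
    next
      case False
      then have "q y < 0" using q y(1) by force
      \<comment> \<open>Replaces the limit of vanishing \<open>\<epsilon>\<close>: for this
        \<open>\<epsilon>\<close> the comparison says that half the potential at \<open>y\<close> is
        nonnegative.\<close>
      then have "potential s I x y / (2 * q y) > 0" using neg by (simp add: zero_less_divide_iff)
      from le[OF this] show ?thesis using \<open>q y < 0\<close> neg by simp
    qed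
  qed
qed

text \<open>Harnack-type step: a point where the potential is positive would, by comparison on an annulus
  around it that contains the origin, force positivity at the origin.\<close>

lemma potential_zero_half_ball:
  fixes x :: "'i \<Rightarrow> 'a::euclidean_space"
  assumes fin: "finite I" and s: "s = real DIM('a) - 2" "s \<ge> 0"
    and sphere: "\<And>y. norm y = 1 \<Longrightarrow> (\<And>i. i \<in> I \<Longrightarrow> image_dist_sq (x i) y > 0) \<Longrightarrow> 0 \<le> potential s I x y"
    and z: "norm z < 1 / 2" "\<And>i. i \<in> I \<Longrightarrow> image_dist_sq (x i) z > 0"
  shows "potential s I x z = 0"
proof (rule ccontr)
  define V where "V = potential s I x"
  have nonneg: "0 \<le> V y" if "norm y \<le> 1" "\<And>i. i \<in> I \<Longrightarrow> image_dist_sq (x i) y > 0" for y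
    unfolding V_def by (rule potential_nonneg_ball[OF fin s sphere that])
  assume "potential s I x z \<noteq> 0"
  then have Vz: "V z > 0" and "z \<noteq> 0" using nonneg[of z] z by (auto simp: V_def)
  define W where "W = (\<Inter>i\<in>I. {y. 0 < image_dist_sq (x i) y})"
  have "open W" unfolding W_def
    by (intro open_INT fin ballI open_Collect_less continuous_intros)
  have "z \<in> W" using z by (simp add: W_def)
  have "continuous_on W V"
    unfolding V_def by (rule continuous_on_potential) (auto simp: W_def)
  then have "isCont V z" using \<open>open W\<close> \<open>z \<in> W\<close> by (simp add: continuous_on_eq_continuous_at)
  then have "\<forall>\<^sub>F y in nhds z. V z / 2 < V y"
    using Vz by (intro order_tendstoD(1)[where y = "V z"]) (auto simp: continuous_within tendsto_at_iff_tendsto_nhds)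
  then obtain e where e: "e > 0" "\<And>y. dist y z < e \<Longrightarrow> V z / 2 < V y"
    unfolding eventually_nhds_metric by auto
  \<comment> \<open>The inner radius: on that sphere \<open>V\<close> exceeds
    \<open>V z / 2\<close>, and the origin stays outside it.\<close>
  define \<eta> where "\<eta> = min e (norm z) / 2"
  have \<eta>: "0 < \<eta>" "\<eta> < e" "\<eta> < norm z"
  proof -
    have "norm z > 0" using \<open>z \<noteq> 0\<close> by simp
    then show "0 < \<eta>" "\<eta> < e" "\<eta> < norm z"
      using e(1) by (simp_all add: \<eta>_def min_def)
  qed
  \<comment> \<open>As \<open>norm z < 1 / 2\<close>, the ball of radius \<open>R\<close> about
    \<open>z\<close> contains the origin and still lies in the unit ball.\<close>
  define R where "R = 1 - norm z"
  have R: "norm z < R" using z by (simp add: R_def)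
  define q where "q t = kern (s + 1) (t\<^sup>2)" for t
  have q_gap: "q R < q t" if "0 < t" "t < R" for t
    unfolding q_def using that by (intro kern_strict_antimono) (auto intro: power_strict_mono)
  \<comment> \<open>Scaled so that \<open>\<epsilon> * (q t - q R)\<close> is 0 on the outer sphere
    and \<open>V z / 2\<close> on the inner one. It is positive at the distance of the origin, where
    the potential is 0.\<close>
  define \<epsilon> where "\<epsilon> = V z / 2 / (q \<eta> - q R)"
  have \<epsilon>: "\<epsilon> > 0" "\<epsilon> * (q \<eta> - q R) = V z / 2"
  proof -
    have "q \<eta> - q R > 0" using q_gap[of \<eta>] \<eta> R by simp
    then show "\<epsilon> > 0" "\<epsilon> * (q \<eta> - q R) = V z / 2"
      using Vz nonzero_eq_divide_eq[of "q \<eta> - q R" \<epsilon> "V z / 2"] by (auto simp: \<epsilon>_def)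
  qed
  define K where "K = cball z R - ball z \<eta>"
  have "- \<epsilon> * q R \<le> potential s I x 0 - \<epsilon> * kern (s + 1) ((norm (0 - z))\<^sup>2)"
  proof (rule potential_comparison[OF fin s])
    show "compact K" unfolding K_def by (intro compact_diff) auto
    show "z \<notin> K" using \<eta> by (simp add: K_def)
    show "0 \<in> K" using \<eta> R by (simp add: K_def)
    fix w assume w: "w \<in> K - interior K" "\<And>i. i \<in> I \<Longrightarrow> image_dist_sq (x i) w > 0"
    have "ball z R - cball z \<eta> \<subseteq> interior K"
      by (rule interior_maximal) (auto simp: K_def)
    then have "w \<notin> ball z R - cball z \<eta>" using w(1) by blast
    moreover have "dist w z \<le> R" "\<eta> \<le> dist w z" using w(1) by (auto simp: K_def dist_commute)
    ultimately have "dist w z = R \<or> dist w z = \<eta>" by (simp add: dist_commute)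
    then show "- \<epsilon> * q R \<le> potential s I x w - \<epsilon> * kern (s + 1) ((norm (w - z))\<^sup>2)"
    proof
      assume d: "dist w z = R"
      have "norm w \<le> 1" using norm_triangle_ineq2[of w z] d by (simp add: R_def dist_norm)
      then show ?thesis using nonneg[of w] w(2) d by (simp add: V_def q_def dist_norm)
    next
      assume d: "dist w z = \<eta>"
      then have "V z / 2 \<le> V w" using e(2)[of w] \<eta> by simp
      then show ?thesis using \<epsilon>(2) d by (simp add: V_def q_def dist_norm algebra_simps)
    qed
  qed (use \<epsilon> in \<open>auto simp: image_dist_sq_def\<close>)
  then have "\<epsilon> * q (norm z) \<le> \<epsilon> * q R" by (simp add: q_def)
  moreover have "q R < q (norm z)" using q_gap[of "norm z"] \<open>z \<noteq> 0\<close> R by simp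
  ultimately show False using \<epsilon>(1) by simp
qed

section \<open>Continuation along a ray\<close>

text \<open>For real \<open>t\<close> the quadratic factors as
  \<open>(1 - t * w) * (1 - t * cnj w)\<close>, both factors having positive real part. The left
  side also makes sense for complex \<open>t\<close> and so continues the real power.\<close>

lemma exp_Ln_conjugate_pair:
  fixes t a :: real and w :: complex
  assumes "\<bar>t\<bar> * cmod w < 1"
  shows "exp (of_real a * (Ln (1 - of_real t * w) + Ln (1 - of_real t * cnj w))) =
    of_real ((1 - 2 * t * Re w + t\<^sup>2 * (cmod w)\<^sup>2) powr a)"
proof -
  define v where "v = 1 - of_real t * w"
  have "\<bar>Re (of_real t * w)\<bar> < 1"
    using assms abs_Re_le_cmod[of "of_real t * w"] by (simp add: norm_mult)
  then have v: "Re v > 0" by (simp add: v_def)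
  then have "v \<notin> \<real>\<^sub>\<le>\<^sub>0" "v \<noteq> 0" by (auto simp: complex_nonpos_Reals_iff)
  have "1 - of_real t * cnj w = cnj v" by (simp add: v_def)
  then have "Ln (1 - of_real t * w) + Ln (1 - of_real t * cnj w) = Ln v + cnj (Ln v)"
    using cnj_Ln[OF \<open>v \<notin> \<real>\<^sub>\<le>\<^sub>0\<close>] by (simp add: v_def)
  also have "\<dots> = of_real (2 * ln (cmod v))"
    using \<open>v \<noteq> 0\<close> by (simp add: complex_add_cnj)
  also have "2 * ln (cmod v) = ln ((cmod v)\<^sup>2)"
    using \<open>v \<noteq> 0\<close> by (simp add: ln_realpow)
  finally have "exp (of_real a * (Ln (1 - of_real t * w) + Ln (1 - of_real t * cnj w))) =
      of_real (((cmod v)\<^sup>2) powr a)"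
    using \<open>v \<noteq> 0\<close> by (simp add: powr_def flip: exp_of_real)
  moreover have "(cmod v)\<^sup>2 = 1 - 2 * t * Re w + t\<^sup>2 * (cmod w)\<^sup>2"
    unfolding cmod_power2 v_def by (simp add: power2_eq_square algebra_simps)
  ultimately show ?thesis by simp
qed

text \<open>The derivative along the ray extends holomorphically to the disc of radius
  \<open>1 / r\<close> and vanishes on an interval ending at 0, hence identically. The derivative is
  continued, not the potential itself, because it is built from powers for every \<open>s\<close>,
  the logarithmic case included.\<close>

lemma potential_zero_ray:
  fixes x :: "'i \<Rightarrow> 'a::real_inner"
  assumes fin: "finite I" and "norm u = 1" and "r > 0" "\<And>i. i \<in> I \<Longrightarrow> norm (x i) \<le> r"
    and "\<tau> > 0" and zero: "\<And>t. 0 < t \<Longrightarrow> t < \<tau> \<Longrightarrow> potential s I x (t *\<^sub>R u) = 0"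
    and t: "0 \<le> t" "t < 1 / r"
  shows "potential s I x (t *\<^sub>R u) = 0"
proof -
  define c where "c i = x i \<bullet> u" for i
  define n where "n i = norm (x i)" for i
  \<comment> \<open>Real part \<open>c i\<close> and modulus \<open>n i\<close>, so that
    \<open>Q i t\<close> is the squared modulus of \<open>1 - t * w i\<close>. Cauchy-Schwarz makes
    the radicand nonnegative.\<close>
  define w where "w i = Complex (c i) (sqrt ((n i)\<^sup>2 - (c i)\<^sup>2))" for i
  have "(c i)\<^sup>2 \<le> (n i)\<^sup>2" for i
    using Cauchy_Schwarz_ineq2[of "x i" u] assms(2) by (simp add: c_def n_def abs_le_square_iff[symmetric])
  then have w: "Re (w i) = c i" "cmod (w i) = n i" for i
    by (auto simp: w_def cmod_def n_def)
  define Q where "Q i t = 1 - 2 * t * c i + t\<^sup>2 * (n i)\<^sup>2" for i t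
  have u1: "u \<bullet> u = 1" using assms(2) by (simp add: norm_eq_1)
  have Q: "image_dist_sq (x i) (t *\<^sub>R u) = Q i t" for i t
    using u1 by (simp add: image_dist_sq_def Q_def c_def n_def power2_norm_eq_inner)
       (simp add: power2_eq_square)
  have small: "\<bar>t\<bar> * n i < 1" if "i \<in> I" "\<bar>t\<bar> < 1 / r" for i t
  proof -
    have "\<bar>t\<bar> * n i \<le> \<bar>t\<bar> * r" using assms(4)[OF that(1)] by (simp add: n_def mult_left_mono)
    also have "\<dots> < 1" using that(2) \<open>r > 0\<close> by (simp add: field_simps)
    finally show ?thesis .
  qed
  have Qpos: "Q i t > 0" if "i \<in> I" "\<bar>t\<bar> < 1 / r" for i t
  proof -
    have "0 < (1 - \<bar>t\<bar> * n i)\<^sup>2" using small[OF that] by simp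
    also have "\<dots> \<le> Q i t"
      using image_dist_sq_ge[of "x i" "t *\<^sub>R u"] assms(2) by (simp add: Q n_def mult.commute)
    finally show ?thesis .
  qed
  define V where "V t = potential s I x (t *\<^sub>R u)" for t
  define V' where "V' t = (\<Sum>i\<in>I. - (Q i t powr (- s / 2 - 1)) / 2 * (- 2 * c i + 2 * t * (n i)\<^sup>2))" for t
  have V': "(V has_real_derivative V' t) (at t)" if "\<bar>t\<bar> < 1 / r" for t
    unfolding V_def potential_def Q V'_def
  proof (rule DERIV_sum)
    fix i assume "i \<in> I"
    have "(Q i has_real_derivative (- 2 * c i + 2 * t * (n i)\<^sup>2)) (at t)"
      unfolding Q_def by (auto intro!: derivative_eq_intros)
    then show "((\<lambda>t. kern s (Q i t)) has_real_derivative
        - (Q i t powr (- s / 2 - 1)) / 2 * (- 2 * c i + 2 * t * (n i)\<^sup>2)) (at t)"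
      by (rule DERIV_chain2[where f = "kern s" and g = "Q i", OF DERIV_kern[OF Qpos[OF \<open>i \<in> I\<close> that]]])
  qed
  define G where "G \<zeta> = (\<Sum>i\<in>I. - exp (of_real (- s / 2 - 1) * (Ln (1 - \<zeta> * w i) + Ln (1 - \<zeta> * cnj (w i)))) / 2 *
      (- 2 * of_real (c i) + 2 * \<zeta> * (of_real (n i))\<^sup>2))" for \<zeta>
  have G_real: "G (of_real t) = of_real (V' t)" if "\<bar>t\<bar> < 1 / r" for t
    unfolding G_def V'_def of_real_sum
  proof (rule sum.cong[OF refl])
    fix i assume "i \<in> I"
    then have "exp (of_real (- s / 2 - 1) * (Ln (1 - of_real t * w i) + Ln (1 - of_real t * cnj (w i)))) =
        of_real (Q i t powr (- s / 2 - 1))"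
      using exp_Ln_conjugate_pair[of t "w i" "- s / 2 - 1"] small[OF _ that] by (simp add: w Q_def)
    then show "- exp (of_real (- s / 2 - 1) * (Ln (1 - of_real t * w i) + Ln (1 - of_real t * cnj (w i)))) / 2 *
        (- 2 * of_real (c i) + 2 * of_real t * (of_real (n i))\<^sup>2) =
        complex_of_real (- (Q i t powr (- s / 2 - 1)) / 2 * (- 2 * c i + 2 * t * (n i)\<^sup>2))"
      by (simp only:) simp
  qed
  \<comment> \<open>On the disc the arguments of \<open>Ln\<close> stay in the right half-plane,
    away from the branch cut.\<close>
  have slit: "1 - \<zeta> * v \<notin> \<real>\<^sub>\<le>\<^sub>0" if "cmod \<zeta> < 1 / r" "cmod v \<le> r" for \<zeta> v
  proof -
    have "cmod (\<zeta> * v) \<le> cmod \<zeta> * r" using that(2) by (simp add: norm_mult mult_left_mono)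
    also have "\<dots> < 1" using that(1) \<open>r > 0\<close> by (simp add: field_simps)
    finally have "Re (\<zeta> * v) < 1" using complex_Re_le_cmod[of "\<zeta> * v"] by simp
    then have "0 < Re (1 - \<zeta> * v)" by (simp del: times_complex.sel)
    then show ?thesis by (simp add: complex_nonpos_Reals_iff del: times_complex.sel minus_complex.sel)
  qed
  have holo: "G holomorphic_on ball 0 (1 / r)"
    unfolding G_def
    by (intro holomorphic_intros slit) (use assms(4) w(2) in \<open>auto simp: n_def\<close>)
  define \<rho> where "\<rho> = min \<tau> (1 / r)"
  have \<rho>: "\<rho> > 0" using assms by (simp add: \<rho>_def)
  have "V' t = 0" if "0 < t" "t < \<rho>" for t
  proof -
    have "(V has_real_derivative 0) (at t)"
      by (rule has_field_derivative_transform_within_open[where f = "\<lambda>_. 0" and S = "{0<..<\<rho>}"])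
         (use that zero in \<open>auto simp: V_def \<rho>_def\<close>)
    then show ?thesis using DERIV_unique[OF V'[of t]] that by (simp add: \<rho>_def)
  qed
  then have "G \<zeta> = 0" if "\<zeta> \<in> of_real ` {0<..<\<rho>}" for \<zeta>
    using that G_real by (auto simp: \<rho>_def)
  moreover have "(0::complex) islimpt of_real ` {0<..<\<rho>}"
    unfolding islimpt_approachable
  proof (intro allI impI)
    fix e :: real assume "e > 0"
    then show "\<exists>y\<in>of_real ` {0<..<\<rho>}. y \<noteq> 0 \<and> dist y (0::complex) < e"
      using \<rho> by (intro bexI[of _ "of_real (min e \<rho> / 2)"] imageI) auto
  qed
  moreover have "of_real ` {0<..<\<rho>} \<subseteq> ball (0::complex) (1 / r)" by (auto simp: \<rho>_def)
  ultimately have "G \<zeta> = 0" if "\<zeta> \<in> ball 0 (1 / r)" for \<zeta>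
    using analytic_continuation[OF holo open_ball connected_ball, of "of_real ` {0<..<\<rho>}" 0 \<zeta>] \<open>r > 0\<close> that
    by auto
  then have V'0: "V' t = 0" if "\<bar>t\<bar> < 1 / r" for t
    using G_real[OF that] that by (metis dist_0_norm mem_ball norm_of_real of_real_eq_0_iff)
  have "\<exists>C. \<forall>t\<in>{0..<1 / r}. V t = C"
  proof (rule has_field_derivative_zero_constant)
    fix t assume "t \<in> {0..<1 / r}"
    then have "\<bar>t\<bar> < 1 / r" by simp
    with V'[of t] V'0[of t] show "(V has_real_derivative 0) (at t within {0..<1 / r})"
      by (simp add: has_field_derivative_at_within)
  qed simp
  then have "V t = V 0" using t \<open>r > 0\<close> by auto
  then show ?thesis by (simp add: V_def)
qed

text \<open>Taking \<open>x j\<close> of maximal norm \<open>r\<close> ensures that the ray through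
  it meets no pole before parameter \<open>1 / r\<close>, where the \<open>j\<close>-th summand
  blows up.\<close>

lemma potential_nonneg_sphere_imp_centred:
  fixes x :: "'i \<Rightarrow> 'a::euclidean_space"
  assumes fin: "finite I" and s: "s = real DIM('a) - 2" "s \<ge> 0"
    and sphere: "\<And>y. norm y = 1 \<Longrightarrow> (\<And>i. i \<in> I \<Longrightarrow> x i \<noteq> y) \<Longrightarrow>
        0 \<le> (\<Sum>i\<in>I. kern s ((norm (x i - y))\<^sup>2))"
    and "k \<in> I"
  shows "x k = 0"
proof (rule ccontr)
  assume "x k \<noteq> 0"
  have sphere': "0 \<le> potential s I x y"
    if "norm y = 1" "\<And>i. i \<in> I \<Longrightarrow> image_dist_sq (x i) y > 0" for y
  proof -
    have "x i \<noteq> y" if "i \<in> I" for i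
      using \<open>\<And>i. i \<in> I \<Longrightarrow> image_dist_sq (x i) y > 0\<close>[OF that] image_dist_sq_sphere[OF \<open>norm y = 1\<close>] by auto
    then show ?thesis
      using sphere[OF that(1)] by (simp add: potential_def image_dist_sq_sphere[OF that(1)])
  qed
  obtain j where j: "j \<in> I" "\<And>i. i \<in> I \<Longrightarrow> norm (x i) \<le> norm (x j)"
  proof -
    have "Max ((\<lambda>i. norm (x i)) ` I) \<in> (\<lambda>i. norm (x i)) ` I"
      using fin \<open>k \<in> I\<close> by (intro Max_in) auto
    then obtain j where j: "j \<in> I" "Max ((\<lambda>i. norm (x i)) ` I) = norm (x j)" by auto
    then show ?thesis using fin by (intro that[of j]) (auto simp flip: j(2))
  qed
  define r where "r = norm (x j)"
  have "r > 0" using j(2)[OF \<open>k \<in> I\<close>] \<open>x k \<noteq> 0\<close> unfolding r_def by (metis norm_le_zero_iff not_less order_trans zero_less_norm_iff)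
  define u where "u = x j /\<^sub>R r"
  have u: "norm u = 1" "x j \<bullet> u = r"
    using \<open>r > 0\<close> by (auto simp: u_def r_def power2_norm_eq_inner[symmetric] power2_eq_square)
  have pos: "image_dist_sq (x i) (t *\<^sub>R u) > 0" if "i \<in> I" "0 \<le> t" "t < 1 / r" for i t
  proof -
    have "norm (x i) * t \<le> r * t" using j(2)[OF that(1)] that(2) by (simp add: r_def mult_right_mono)
    also have "\<dots> < 1" using that(3) \<open>r > 0\<close> by (simp add: field_simps)
    finally have "0 < (1 - norm (x i) * norm (t *\<^sub>R u))\<^sup>2" using u that(2) by simp
    also have "\<dots> \<le> image_dist_sq (x i) (t *\<^sub>R u)" by (rule image_dist_sq_ge)
    finally show ?thesis .
  qed
  have zero: "potential s I x (t *\<^sub>R u) = 0" if "0 \<le> t" "t < 1 / r" for t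
  proof (rule potential_zero_ray[OF fin u(1) \<open>r > 0\<close>, where \<tau> = "min (1 / 2) (1 / r)"])
    fix t assume "0 < t" "t < min (1 / 2) (1 / r)"
    then show "potential s I x (t *\<^sub>R u) = 0"
      using u pos by (intro potential_zero_half_ball[OF fin s sphere']) auto
  qed (use j \<open>r > 0\<close> that in \<open>auto simp: r_def\<close>)
  obtain \<delta> where \<delta>: "\<delta> > 0"
    "\<And>y j. y \<in> cball 0 (1 / r) \<Longrightarrow> (\<And>i. i \<in> I \<Longrightarrow> image_dist_sq (x i) y > 0) \<Longrightarrow> j \<in> I \<Longrightarrow>
        image_dist_sq (x j) y \<le> \<delta> \<Longrightarrow> 1 \<le> potential s I x y"
    using potential_large_near_poles[OF fin s(2) bounded_cball] by metis
  \<comment> \<open>At parameter \<open>(1 - h) / r\<close> the image distance of \<open>x j\<close>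
    is \<open>h\<^sup>2\<close>, hence at most \<open>\<delta>\<close>; the cap \<open>1 / 2\<close>
    keeps the parameter positive.\<close>
  define h where "h = min (1 / 2) (sqrt \<delta>)"
  have h: "0 < h" "h < 1" "h\<^sup>2 \<le> \<delta>"
    using \<delta>(1) power_mono[of h "sqrt \<delta>" 2] by (auto simp: h_def)
  define t where "t = (1 - h) / r"
  have t: "0 \<le> t" "t < 1 / r" using h \<open>r > 0\<close> by (auto simp: t_def divide_strict_right_mono)
  have "image_dist_sq (x j) (t *\<^sub>R u) = (1 - r * t)\<^sup>2"
    using u by (simp add: image_dist_sq_def norm_eq_1 r_def power2_norm_eq_inner[symmetric])
       (simp add: power2_eq_square algebra_simps)
  also have "\<dots> = h\<^sup>2" using \<open>r > 0\<close> by (simp add: t_def)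
  finally have "1 \<le> potential s I x (t *\<^sub>R u)"
    using h j(1) pos t u by (intro \<delta>(2)[of _ j]) auto
  then show False using zero[OF t] by simp
qed

section \<open>Polarization\<close>

definition kernel_at_one :: "real \<Rightarrow> real" where
  "kernel_at_one s = (if s > 0 then 1 else if s = 0 then 0 else - 1)"

text \<open>The factor is positive for every \<open>s\<close>: for \<open>s < 0\<close> the sign in
  the Riesz kernel cancels that of the division by \<open>s\<close>. Inequalities thus pass between
  the two kernels.\<close>

lemma riesz_kernel_eq_kern:
  assumes "x \<noteq> y"
  shows "riesz_kernel s x y =
    ereal ((if s = 0 then 1 else \<bar>s\<bar>) * kern s ((norm (x - y))\<^sup>2) + kernel_at_one s)"
proof -
  have "((norm (x - y))\<^sup>2) powr (- s / 2) = norm (x - y) powr (- s)"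
    using assms by (simp add: powr_powr flip: powr_numeral)
  moreover have "ln ((norm (x - y))\<^sup>2) = 2 * ln (norm (x - y))"
    using assms by (simp add: ln_realpow)
  ultimately show ?thesis
    using assms by (auto simp: riesz_kernel_def kern_def kernel_at_one_def)
qed

lemma riesz_kernel_origin_ge:
  assumes "norm y \<le> 1"
  shows "ereal (kernel_at_one s) \<le> riesz_kernel s 0 y"
proof (cases "y = 0")
  case True
  \<comment> \<open>For \<open>s < 0\<close> the kernel at its pole is 0, still above its value -1
    at distance one.\<close>
  then show ?thesis by (auto simp: riesz_kernel_def kernel_at_one_def)
next
  case False
  then have "kern s 1 \<le> kern s ((norm y)\<^sup>2)"
    using assms by (intro kern_antimono) (auto simp: power_le_one)
  then show ?thesis using False riesz_kernel_eq_kern[of 0 y s] by auto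
qed

lemma riesz_kernel_origin_sphere:
  assumes "norm y = 1"
  shows "riesz_kernel s 0 y = ereal (kernel_at_one s)"
proof -
  have "0 \<noteq> y" using assms by auto
  then show ?thesis using assms riesz_kernel_eq_kern[of 0 y s] by auto
qed

text \<open>On the closed ball the kernel from the origin is smallest on the sphere. The set
  \<open>A\<close> contains the sphere and stays in the ball, so the infimum is the value
  there.\<close>

lemma polarization_replicate_origin:
  fixes A :: "(real ^ 'p) set"
  assumes "sphere 0 1 \<subseteq> A" "A \<subseteq> cball 0 1"
  shows "polarization s A (replicate_mset N 0) = ereal (N * kernel_at_one s)"
proof -
  have sum: "(\<Sum>x\<in>#replicate_mset N (0::real^'p). f x) = (\<Sum>i<N. f 0)" for f :: "_ \<Rightarrow> ereal"
    by (induction N) (auto simp: add.commute)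
  have const: "(\<Sum>i<N. ereal (kernel_at_one s)) = ereal (N * kernel_at_one s)"
    by (simp only: sum_ereal) simp
  show ?thesis
    unfolding polarization_def sum
  proof (rule antisym)
    obtain b :: "real ^ 'p" where "b \<in> Basis" using nonempty_Basis by blast
    then have b: "norm b = 1" "b \<in> A" using assms(1) by auto
    show "(INF y\<in>A. \<Sum>i<N. riesz_kernel s (0::real^'p) y) \<le> ereal (N * kernel_at_one s)"
      using INF_lower[OF b(2), of "\<lambda>y. \<Sum>i<N. riesz_kernel s 0 y"]
      unfolding riesz_kernel_origin_sphere[OF b(1)] const .
    show "ereal (N * kernel_at_one s) \<le> (INF y\<in>A. \<Sum>i<N. riesz_kernel s (0::real^'p) y)"
      unfolding const[symmetric]
      by (intro INF_greatest sum_mono riesz_kernel_origin_ge) (use assms(2) in auto)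
  qed
qed

text \<open>Only points of the sphere outside the configuration are tested. There all kernel values
  are finite, so the offsets \<open>kernel_at_one s\<close> cancel and the positive factor divides
  out.\<close>

lemma polarization_ge_imp_centred:
  fixes A :: "(real ^ 'p) set"
  assumes "CARD('p) \<ge> 2" "s \<le> real CARD('p) - 2" "sphere 0 1 \<subseteq> A"
    and ge: "ereal (size \<omega> * kernel_at_one s) \<le> polarization s A \<omega>"
  shows "\<forall>x\<in>#\<omega>. x = 0"
proof -
  \<comment> \<open>Listing the multiset indexes its points with repetitions kept.\<close>
  obtain xs where xs: "mset xs = \<omega>" using ex_mset by blast
  define I where "I = {..<length xs}"
  have sum: "(\<Sum>x\<in>#\<omega>. f x) = (\<Sum>i\<in>I. f (xs ! i))" for f :: "_ \<Rightarrow> ereal"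
    unfolding xs[symmetric] I_def
    by (simp add: sum_mset_sum_list sum_list_sum_nth atLeast0LessThan flip: mset_map)
  have "xs ! k = 0" if "k \<in> I" for k
  proof (rule potential_nonneg_sphere_imp_centred[where I = I and s = "real CARD('p) - 2" and x = "\<lambda>i. xs ! i"])
    fix y :: "real ^ 'p" assume y: "norm y = 1" "\<And>i. i \<in> I \<Longrightarrow> xs ! i \<noteq> y"
    define a where "a = (if s = 0 then 1 else \<bar>s\<bar>)"
    have "a > 0" by (simp add: a_def)
    have "ereal (size \<omega> * kernel_at_one s) \<le> (\<Sum>x\<in>#\<omega>. riesz_kernel s x y)"
      using ge y(1) assms(3) unfolding polarization_def by (elim order_trans) (auto intro!: INF_lower)
    also have "\<dots> = (\<Sum>i\<in>I. ereal (a * kern s ((norm (xs ! i - y))\<^sup>2) + kernel_at_one s))"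
      unfolding sum a_def by (intro sum.cong refl riesz_kernel_eq_kern y)
    also have "\<dots> = ereal (a * (\<Sum>i\<in>I. kern s ((norm (xs ! i - y))\<^sup>2)) + size \<omega> * kernel_at_one s)"
      by (simp add: sum.distrib sum_distrib_left I_def flip: xs)
    finally have "0 \<le> (\<Sum>i\<in>I. kern s ((norm (xs ! i - y))\<^sup>2))"
      using \<open>a > 0\<close> by (simp add: zero_le_mult_iff)
    \<comment> \<open>The passage from \<open>s\<close> to the harmonic exponent.\<close>
    also have "\<dots> \<le> (\<Sum>i\<in>I. kern (real CARD('p) - 2) ((norm (xs ! i - y))\<^sup>2))"
      by (intro sum_mono kern_mono_exponent) (use assms(2) y(2) in auto)
    finally show "0 \<le> (\<Sum>i\<in>I. kern (real CARD('p) - 2) ((norm (xs ! i - y))\<^sup>2))" .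
  qed (use assms(1) that in \<open>auto simp: I_def\<close>)
  then show ?thesis by (auto simp: I_def in_set_conv_nth simp flip: xs)
qed

theorem proposition2p2:
  fixes s :: real and N :: nat
    and A :: "(real ^ 'p) set" and \<omega> :: "(real ^ 'p) multiset"
  assumes "CARD('p) \<ge> 2"
    and "s \<le> real CARD('p) - 2"
    and "compact A"
    and "sphere 0 1 \<subseteq> A" and "A \<subseteq> cball 0 1"
    and "size \<omega> = N"
  shows "polarization s A \<omega> = max_polarization s A N \<longleftrightarrow> (\<forall>x\<in>#\<omega>. x = 0)"
proof -
  define c where "c = ereal (N * kernel_at_one s)"
  have centred: "polarization s A \<omega>' = c" if "size \<omega>' = N" "\<forall>x\<in>#\<omega>'. x = 0" for \<omega>'
  proof -
    have "\<omega>' = replicate_mset N 0"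
      using that by (metis set_mset_subset_singletonD singletonI subsetI)
    then show ?thesis using polarization_replicate_origin[OF assms(4,5)] by (simp add: c_def)
  qed
  have ge: "\<forall>x\<in>#\<omega>'. x = 0" if "size \<omega>' = N" "c \<le> polarization s A \<omega>'" for \<omega>'
    using polarization_ge_imp_centred[OF assms(1,2,4), of \<omega>'] that by (simp add: c_def)
  have "max_polarization s A N = c"
    unfolding max_polarization_def
  proof (rule antisym)
    show "(SUP \<omega>\<in>{\<omega>. size \<omega> = N}. polarization s A \<omega>) \<le> c"
      \<comment> \<open>By linearity of the order, a value not at most \<open>c\<close> is at least
        \<open>c\<close>; then all points are at the origin and the value is \<open>c\<close>
        itself.\<close>
      by (rule SUP_least) (metis centred ge linear mem_Collect_eq order_refl)
    show "c \<le> (SUP \<omega>\<in>{\<omega>. size \<omega> = N}. polarization s A \<omega>)"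
      by (rule SUP_upper2[of "replicate_mset N 0"]) (auto simp: centred split: if_splits)
  qed
  then show ?thesis using centred[OF assms(6)] ge[OF assms(6)] by auto
qed

end
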